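(* Let $s\geq 2$ and let $\phi:\mathbb{R}^s\times\mathbb{R}^s\to\mathbb{R}$ be the nonnegative symmetric function defined in the context. Then the completion $(\overline{\mathbb{R}^s},\rho_\phi)$ of $(\mathbb{R}^s,d^\phi)$ is homeomorphic to the Euclidean closed unit ball $B^s=\{x\in\mathbb{R}^s\mid d_E(O,x)\leq 1\}$ with the Euclidean metric.
   Context: $d_E$ is the Euclidean metric on $\mathbb{R}^s$ and $O=(0,\dots,0)$. For $m\in\mathbb{N}=\{1,2,\dots\}$ let $a_m=1+\frac12+\cdots+\frac1m$ and $S_m=\{x\in\mathbb{R}^s\mid d_E(O,x)=a_m\}$. For $p,q\in\mathbb{N}$ let $h_{p,q}:S_p\to S_q$, $h_{p,q}(x)=\frac{a_q}{a_p}x$. Define $$\phi(x,y)=\begin{cases}0 & \text{if } h_{p,q}(x)=y \text{ for some } p,q\in\mathbb{N},\\ \frac{1}{a_m}d_E(x,y) & \text{if } x,y\in S_m\text{ for some } m\in\mathbb{N},\\ d_E(x,y) & \text{otherwise.}\end{cases}$$ Put $$\delta^\phi(x,y)=\min\left\{d_E(x,y),\ \frac{1}{1+d_E(O,x)}+\phi(x,y)+\frac{1}{1+d_E(O,y)}\right\}$$ and $$d^\phi(x,y)=\inf\sum_{i=1}^n\delta^\phi(x_{i-1},x_i),$$ the infimum being over all $n\in\mathbb{N}$ and all tuples $(x_0,\dots,x_n)$ of points of $\mathbb{R}^s$ with $x_0=x$, $x_n=y$. The function $d^\phi$ is a metric on $\mathbb{R}^s$. The completion $(\overline{\mathbb{R}^s},\rho_\phi)$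 is the set of equivalence classes of Cauchy sequences in $(\mathbb{R}^s,d^\phi)$ under $\{x_i\}\sim\{y_i\}\iff\lim_i d^\phi(x_i,y_i)=0$, with metric $\rho_\phi(\{x_i\},\{y_i\})=\lim_i d^\phi(x_i,y_i)$. *)

theory Defs
  imports "HOL-Analysis.Analysis"
begin

section \<open>The completion of a metric space by Cauchy sequences\<close>

definition Cauchy_seqs :: "'a set \<Rightarrow> ('a \<Rightarrow> 'a \<Rightarrow> real) \<Rightarrow> (nat \<Rightarrow> 'a) set"
  where "Cauchy_seqs M d = {\<sigma>. Metric_space.MCauchy M d \<sigma>}"

definition Cauchy_equiv :: "'a set \<Rightarrow> ('a \<Rightarrow> 'a \<Rightarrow> real) \<Rightarrow> ((nat \<Rightarrow> 'a) \<times> (nat \<Rightarrow> 'a)) set"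
  where "Cauchy_equiv M d =
    {(\<sigma>, \<tau>). \<sigma> \<in> Cauchy_seqs M d \<and> \<tau> \<in> Cauchy_seqs M d \<and>
      (\<lambda>i. d (\<sigma> i) (\<tau> i)) \<longlonglongrightarrow> 0}"

definition Cauchy_completion :: "'a set \<Rightarrow> ('a \<Rightarrow> 'a \<Rightarrow> real) \<Rightarrow> (nat \<Rightarrow> 'a) set set"
  where "Cauchy_completion M d = Cauchy_seqs M d // Cauchy_equiv M d"

text \<open>The value 0 off the carrier is needed because the locale \<^locale>\<open>Metric_space\<close> asks for
  nonnegativity and symmetry on the whole type. On the carrier the limit exists and does not
  depend on the representatives, see \<open>Cauchy_completion_dist_eq\<close> below.\<close>

definition Cauchy_completion_dist ::
    "'a set \<Rightarrow> ('a \<Rightarrow> 'a \<Rightarrow> real) \<Rightarrow> (nat \<Rightarrow> 'a) set \<Rightarrow> (nat \<Rightarrow> 'a) set \<Rightarrow> real"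
  where "Cauchy_completion_dist M d X Y =
    (if X \<in> Cauchy_completion M d \<and> Y \<in> Cauchy_completion M d
     then THE r. \<forall>\<sigma>\<in>X. \<forall>\<tau>\<in>Y. (\<lambda>i. d (\<sigma> i) (\<tau> i)) \<longlonglongrightarrow> r
     else 0)"

context Metric_space
begin

lemma Cauchy_seqs_convergent_dist:
  assumes "\<sigma> \<in> Cauchy_seqs M d" "\<tau> \<in> Cauchy_seqs M d"
  shows "convergent (\<lambda>i. d (\<sigma> i) (\<tau> i))"
proof (rule real_Cauchy_convergent, rule metric_CauchyI)
  fix e :: real assume "e > 0"
  have s: "MCauchy \<sigma>" "MCauchy \<tau>" and rng: "\<And>i. \<sigma> i \<in> M" "\<And>i. \<tau> i \<in> M"
    using assms by (auto simp: Cauchy_seqs_def MCauchy_def)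
  obtain N1 where N1: "\<And>n n'. N1 \<le> n \<Longrightarrow> N1 \<le> n' \<Longrightarrow> d (\<sigma> n) (\<sigma> n') < e/2"
    using s(1) \<open>e > 0\<close> unfolding MCauchy_def by (meson half_gt_zero)
  obtain N2 where N2: "\<And>n n'. N2 \<le> n \<Longrightarrow> N2 \<le> n' \<Longrightarrow> d (\<tau> n) (\<tau> n') < e/2"
    using s(2) \<open>e > 0\<close> unfolding MCauchy_def by (meson half_gt_zero)
  have "dist (d (\<sigma> m) (\<tau> m)) (d (\<sigma> n) (\<tau> n)) < e" if "m \<ge> max N1 N2" "n \<ge> max N1 N2" for m n
  proof -
    have "d (\<sigma> m) (\<tau> m) \<le> d (\<sigma> m) (\<sigma> n) + (d (\<sigma> n) (\<tau> n) + d (\<tau> n) (\<tau> m))"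
      using triangle[of "\<sigma> m" "\<sigma> n" "\<tau> m"] triangle[of "\<sigma> n" "\<tau> n" "\<tau> m"] rng by fastforce
    moreover have "d (\<sigma> n) (\<tau> n) \<le> d (\<sigma> n) (\<sigma> m) + (d (\<sigma> m) (\<tau> m) + d (\<tau> m) (\<tau> n))"
      using triangle[of "\<sigma> n" "\<sigma> m" "\<tau> n"] triangle[of "\<sigma> m" "\<tau> m" "\<tau> n"] rng by fastforce
    ultimately show ?thesis
      using N1[of m n] N1[of n m] N2[of m n] N2[of n m] that by (auto simp: dist_real_def)
  qed
  then show "\<exists>N. \<forall>m\<ge>N. \<forall>n\<ge>N. dist (d (\<sigma> m) (\<tau> m)) (d (\<sigma> n) (\<tau> n)) < e"
    by blast
qed

lemma Cauchy_equiv_dist_limit: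
  assumes "(\<sigma>, \<sigma>') \<in> Cauchy_equiv M d" "(\<tau>, \<tau>') \<in> Cauchy_equiv M d"
    and "(\<lambda>i. d (\<sigma> i) (\<tau> i)) \<longlonglongrightarrow> r"
  shows "(\<lambda>i. d (\<sigma>' i) (\<tau>' i)) \<longlonglongrightarrow> r"
proof -
  have rng: "\<And>i. \<sigma> i \<in> M" "\<And>i. \<tau> i \<in> M" "\<And>i. \<sigma>' i \<in> M" "\<And>i. \<tau>' i \<in> M"
    using assms by (auto simp: Cauchy_equiv_def Cauchy_seqs_def MCauchy_def)
  have lim: "(\<lambda>i. d (\<sigma> i) (\<sigma>' i) + d (\<tau> i) (\<tau>' i)) \<longlonglongrightarrow> 0"
    using assms tendsto_add[of "\<lambda>i. d (\<sigma> i) (\<sigma>' i)" 0] by (fastforce simp: Cauchy_equiv_def)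
  have "\<bar>d (\<sigma>' i) (\<tau>' i) - d (\<sigma> i) (\<tau> i)\<bar> \<le> d (\<sigma> i) (\<sigma>' i) + d (\<tau> i) (\<tau>' i)" for i
    using triangle[of "\<sigma>' i" "\<sigma> i" "\<tau>' i"] triangle[of "\<sigma> i" "\<tau> i" "\<tau>' i"]
      triangle[of "\<sigma> i" "\<sigma>' i" "\<tau> i"] triangle[of "\<sigma>' i" "\<tau>' i" "\<tau> i"]
      rng commute[of "\<sigma>' i" "\<sigma> i"] commute[of "\<tau>' i" "\<tau> i"] by auto
  then have "(\<lambda>i. d (\<sigma>' i) (\<tau>' i) - d (\<sigma> i) (\<tau> i)) \<longlonglongrightarrow> 0"
    by (intro Lim_null_comparison[OF _ lim]) auto
  from tendsto_add[OF this assms(3)] show ?thesis by simp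
qed

lemma equiv_Cauchy_equiv: "equiv (Cauchy_seqs M d) (Cauchy_equiv M d)"
proof (rule equivI)
  show "Cauchy_equiv M d \<subseteq> Cauchy_seqs M d \<times> Cauchy_seqs M d"
    by (auto simp: Cauchy_equiv_def)
  show refl: "refl_on (Cauchy_seqs M d) (Cauchy_equiv M d)"
    by (auto simp: refl_on_def Cauchy_equiv_def Cauchy_seqs_def MCauchy_def image_subset_iff)
  show sym: "sym (Cauchy_equiv M d)"
    by (auto simp: sym_def Cauchy_equiv_def commute)
  show "trans (Cauchy_equiv M d)"
  proof (rule transI)
    fix x y z assume *: "(x, y) \<in> Cauchy_equiv M d" "(y, z) \<in> Cauchy_equiv M d"
    then have "(x, x) \<in> Cauchy_equiv M d" "(\<lambda>i. d (x i) (y i)) \<longlonglongrightarrow> 0"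
      using refl by (auto simp: refl_on_def Cauchy_equiv_def)
    then show "(x, z) \<in> Cauchy_equiv M d"
      using Cauchy_equiv_dist_limit[of x x y z 0] * by (auto simp: Cauchy_equiv_def)
  qed
qed

lemma Cauchy_completion_dist_eq:
  assumes X: "X \<in> Cauchy_completion M d" and Y: "Y \<in> Cauchy_completion M d"
    and s: "\<sigma> \<in> X" and t: "\<tau> \<in> Y"
  shows "(\<lambda>i. d (\<sigma> i) (\<tau> i)) \<longlonglongrightarrow> Cauchy_completion_dist M d X Y"
proof -
  have "\<sigma> \<in> Cauchy_seqs M d" "\<tau> \<in> Cauchy_seqs M d"
    using assms in_quotient_imp_subset[OF equiv_Cauchy_equiv] by (auto simp: Cauchy_completion_def)
  then obtain r where r: "(\<lambda>i. d (\<sigma> i) (\<tau> i)) \<longlonglongrightarrow> r"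
    using Cauchy_seqs_convergent_dist by (auto simp: convergent_def)
  have all: "\<forall>\<sigma>'\<in>X. \<forall>\<tau>'\<in>Y. (\<lambda>i. d (\<sigma>' i) (\<tau>' i)) \<longlonglongrightarrow> r"
  proof (intro ballI)
    fix \<sigma>' \<tau>' assume "\<sigma>' \<in> X" "\<tau>' \<in> Y"
    then have "(\<sigma>, \<sigma>') \<in> Cauchy_equiv M d" "(\<tau>, \<tau>') \<in> Cauchy_equiv M d"
      using assms quotient_eq_iff[OF equiv_Cauchy_equiv] by (auto simp: Cauchy_completion_def)
    then show "(\<lambda>i. d (\<sigma>' i) (\<tau>' i)) \<longlonglongrightarrow> r"
      using Cauchy_equiv_dist_limit r by blast
  qed
  have "(THE r. \<forall>\<sigma>\<in>X. \<forall>\<tau>\<in>Y. (\<lambda>i. d (\<sigma> i) (\<tau> i)) \<longlonglongrightarrow> r) = r"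
    using all s t r LIMSEQ_unique by (intro the_equality) blast+
  then show ?thesis
    using X Y r by (simp add: Cauchy_completion_dist_def)
qed

lemma Cauchy_completion_nonempty:
  assumes "X \<in> Cauchy_completion M d"
  obtains \<sigma> where "\<sigma> \<in> X" "\<sigma> \<in> Cauchy_seqs M d" "X = Cauchy_equiv M d `` {\<sigma>}"
  using assms equiv_class_self[OF equiv_Cauchy_equiv] by (auto simp: Cauchy_completion_def elim!: quotientE)

lemma Metric_space_Cauchy_completion: "Metric_space (Cauchy_completion M d) (Cauchy_completion_dist M d)"
proof
  fix X Y
  show "0 \<le> Cauchy_completion_dist M d X Y"
  proof (cases "X \<in> Cauchy_completion M d \<and> Y \<in> Cauchy_completion M d")
    case True
    then obtain \<sigma> \<tau> where "\<sigma> \<in> X" "\<tau> \<in> Y" by (meson Cauchy_completion_nonempty)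
    then show ?thesis
      using True by (intro LIMSEQ_le_const[OF Cauchy_completion_dist_eq]) auto
  qed (auto simp: Cauchy_completion_dist_def)
  show "Cauchy_completion_dist M d X Y = Cauchy_completion_dist M d Y X"
  proof (cases "X \<in> Cauchy_completion M d \<and> Y \<in> Cauchy_completion M d")
    case True
    then obtain \<sigma> \<tau> where st: "\<sigma> \<in> X" "\<tau> \<in> Y" by (meson Cauchy_completion_nonempty)
    have "(\<lambda>i. d (\<sigma> i) (\<tau> i)) \<longlonglongrightarrow> Cauchy_completion_dist M d Y X"
      using True st Cauchy_completion_dist_eq[of Y X \<tau> \<sigma>] by (simp add: commute)
    then show ?thesis
      using True st Cauchy_completion_dist_eq[of X Y \<sigma> \<tau>] LIMSEQ_unique by blast
  qed (auto simp: Cauchy_completion_dist_def)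
next
  fix X Y assume XY: "X \<in> Cauchy_completion M d" "Y \<in> Cauchy_completion M d"
  obtain \<sigma> where s: "\<sigma> \<in> X" "\<sigma> \<in> Cauchy_seqs M d" using XY Cauchy_completion_nonempty by metis
  obtain \<tau> where t: "\<tau> \<in> Y" "\<tau> \<in> Cauchy_seqs M d" using XY Cauchy_completion_nonempty by metis
  have lim: "(\<lambda>i. d (\<sigma> i) (\<tau> i)) \<longlonglongrightarrow> Cauchy_completion_dist M d X Y"
    using Cauchy_completion_dist_eq XY s t by blast
  have "X = Y \<longleftrightarrow> (\<sigma>, \<tau>) \<in> Cauchy_equiv M d"
    using quotient_eq_iff[OF equiv_Cauchy_equiv] XY s t by (auto simp: Cauchy_completion_def)
  also have "\<dots> \<longleftrightarrow> Cauchy_completion_dist M d X Y = 0"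
    using lim s t LIMSEQ_unique by (auto simp: Cauchy_equiv_def)
  finally show "Cauchy_completion_dist M d X Y = 0 \<longleftrightarrow> X = Y" by simp
next
  fix X Y Z assume XYZ: "X \<in> Cauchy_completion M d" "Y \<in> Cauchy_completion M d" "Z \<in> Cauchy_completion M d"
  obtain \<sigma> where s: "\<sigma> \<in> X" "\<sigma> \<in> Cauchy_seqs M d" using XYZ Cauchy_completion_nonempty by metis
  obtain \<tau> where t: "\<tau> \<in> Y" "\<tau> \<in> Cauchy_seqs M d" using XYZ Cauchy_completion_nonempty by metis
  obtain \<upsilon> where u: "\<upsilon> \<in> Z" "\<upsilon> \<in> Cauchy_seqs M d" using XYZ Cauchy_completion_nonempty by metis
  have "d (\<sigma> i) (\<upsilon> i) \<le> d (\<sigma> i) (\<tau> i) + d (\<tau> i) (\<upsilon> i)" for i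
    using s t u by (intro triangle) (auto simp: Cauchy_seqs_def MCauchy_def)
  then show "Cauchy_completion_dist M d X Z \<le> Cauchy_completion_dist M d X Y + Cauchy_completion_dist M d Y Z"
    using XYZ s t u
    by (intro LIMSEQ_le[OF Cauchy_completion_dist_eq tendsto_add[OF Cauchy_completion_dist_eq Cauchy_completion_dist_eq]])
      auto
qed

end


section \<open>The metric $d^\phi$\<close>

text \<open>The harmonic number $a_m$ is \<^term>\<open>harm m :: real\<close> from the library. The index set
  $\{1, 2, \dots\}$ is rendered by explicit bounds \<open>1 \<le> m\<close>; note \<^prop>\<open>harm 0 = (0::real)\<close>.\<close>

definition Sm :: "nat \<Rightarrow> (real ^ 'n) set"
  where "Sm m = {x. dist 0 x = harm m}"

definition hpq :: "nat \<Rightarrow> nat \<Rightarrow> real ^ 'n \<Rightarrow> real ^ 'n"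
  where "hpq p q x = (harm q / harm p) *\<^sub>R x"

text \<open>The index \<open>m\<close> in the second case is unique (\<open>Sm_unique\<close>); in the first case \<open>Sm p\<close> is the
  domain of \<open>hpq p q\<close>.\<close>

definition \<phi> :: "real ^ 'n \<Rightarrow> real ^ 'n \<Rightarrow> real"
  where "\<phi> x y =
    (if \<exists>p\<ge>1. \<exists>q\<ge>1. x \<in> Sm p \<and> hpq p q x = y then 0
     else if \<exists>m\<ge>1. x \<in> Sm m \<and> y \<in> Sm m
       then 1 / harm (THE m. 1 \<le> m \<and> x \<in> Sm m \<and> y \<in> Sm m) * dist x y
     else dist x y)"

definition \<delta>\<phi> :: "real ^ 'n \<Rightarrow> real ^ 'n \<Rightarrow> real"
  where "\<delta>\<phi> x y = min (dist x y) (1 / (1 + dist 0 x) + \<phi> x y + 1 / (1 + dist 0 y))"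

text \<open>A tuple $(x_0, \dots, x_n)$ is a function on \<^typ>\<open>nat\<close> of which only the values at
  $0, \dots, n$ are used.\<close>

definition d\<phi> :: "real ^ 'n \<Rightarrow> real ^ 'n \<Rightarrow> real"
  where "d\<phi> x y = Inf {\<Sum>i=1..n. \<delta>\<phi> (z (i - 1)) (z i) | (n::nat) z. 1 \<le> n \<and> z 0 = x \<and> z n = y}"

lemma harm_strict_mono: "m < n \<Longrightarrow> harm m < (harm n :: real)"
  by (rule lift_Suc_mono_less) (simp_all add: harm_Suc)

lemma harm_neq_0: "1 \<le> m \<Longrightarrow> harm m \<noteq> (0::real)"
  using harm_pos[of m, where 'a = real] by linarith

lemma Sm_unique: "x \<in> Sm m \<Longrightarrow> x \<in> Sm n \<Longrightarrow> m = n"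
  using harm_strict_mono[of m n] harm_strict_mono[of n m] by (cases m n rule: linorder_cases) (auto simp: Sm_def)

lemma \<phi>_ray:
  assumes "1 \<le> p" "1 \<le> q" "x \<in> Sm p"
  shows "\<phi> x (hpq p q x) = 0"
  using assms by (auto simp: \<phi>_def)

lemma \<phi>_sphere:
  assumes "1 \<le> m" "x \<in> Sm m" "y \<in> Sm m"
  shows "\<phi> x y = 1 / harm m * dist x y"
proof -
  have "(THE m. 1 \<le> m \<and> x \<in> Sm m \<and> y \<in> Sm m) = m"
    using assms Sm_unique by (intro the_equality) auto
  moreover have "x = y" if "1 \<le> p" "1 \<le> q" "x \<in> Sm p" "hpq p q x = y" for p q
  proof -
    have pos: "harm p \<noteq> (0::real)" "harm q \<noteq> (0::real)" and "norm x = harm p"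
      using that by (auto simp: Sm_def harm_neq_0)
    moreover have "norm y = harm q / harm p * norm x"
      using that by (auto simp: hpq_def harm_nonneg)
    ultimately have "y \<in> Sm q" using pos by (simp add: Sm_def)
    then have "p = q" using assms that(3) Sm_unique by metis
    then show ?thesis using that(4) pos by (simp add: hpq_def)
  qed
  ultimately show ?thesis using assms by (auto simp: \<phi>_def)
qed

lemma \<phi>_nonneg: "0 \<le> \<phi> x y"
  by (simp add: \<phi>_def harm_nonneg)

lemma \<phi>_commute: "\<phi> x y = \<phi> y x"
proof -
  have "\<exists>p\<ge>1. \<exists>q\<ge>1. y \<in> Sm p \<and> hpq p q y = x"
    if *: "\<exists>p\<ge>1. \<exists>q\<ge>1. x \<in> Sm p \<and> hpq p q x = y" for x y :: "real ^ 'n"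
  proof -
    obtain p q where pq: "1 \<le> p" "1 \<le> q" "x \<in> Sm p" "hpq p q x = y" using * by blast
    have "harm p \<noteq> (0::real)" "harm q \<noteq> (0::real)" using pq by (auto simp: harm_neq_0)
    then have "y \<in> Sm q" "hpq q p y = x" using pq by (auto simp: Sm_def hpq_def harm_nonneg)
    then show ?thesis using pq by blast
  qed
  then have "(\<exists>p\<ge>1. \<exists>q\<ge>1. x \<in> Sm p \<and> hpq p q x = y) \<longleftrightarrow> (\<exists>p\<ge>1. \<exists>q\<ge>1. y \<in> Sm p \<and> hpq p q y = x)"
    by blast
  then show ?thesis unfolding \<phi>_def by (simp only: dist_commute[of x y] conj_commute[of "x \<in> Sm _"])
qed

lemma \<delta>\<phi>_nonneg: "0 \<le> \<delta>\<phi> x y"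
  by (simp add: \<delta>\<phi>_def \<phi>_nonneg)

lemma \<delta>\<phi>_commute: "\<delta>\<phi> x y = \<delta>\<phi> y x"
  by (simp add: \<delta>\<phi>_def \<phi>_commute[of x y] dist_commute)

lemma chain_sum_nonneg: "0 \<le> (\<Sum>i=1..(n::nat). \<delta>\<phi> (z (i - 1)) (z i))"
  by (intro sum_nonneg \<delta>\<phi>_nonneg)

lemma d\<phi>_le_chain:
  fixes n :: nat
  assumes "1 \<le> n" "z 0 = x" "z n = y"
  shows "d\<phi> x y \<le> (\<Sum>i=1..n. \<delta>\<phi> (z (i - 1)) (z i))"
  unfolding d\<phi>_def using assms
  by (intro cInf_lower bdd_belowI[where m = 0]) (auto simp: chain_sum_nonneg simp del: One_nat_def)

lemma le_d\<phi>I: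
  assumes "\<And>(n::nat) z. 1 \<le> n \<Longrightarrow> z 0 = x \<Longrightarrow> z n = y \<Longrightarrow> c \<le> (\<Sum>i=1..n. \<delta>\<phi> (z (i - 1)) (z i))"
  shows "c \<le> d\<phi> x y"
  unfolding d\<phi>_def
proof (rule cInf_greatest)
  have "(\<Sum>i=1..1. \<delta>\<phi> ((\<lambda>i::nat. if i = 0 then x else y) (i - 1)) ((\<lambda>i. if i = 0 then x else y) i))
      \<in> {\<Sum>i=1..n. \<delta>\<phi> (z (i - 1)) (z i) | (n::nat) z. 1 \<le> n \<and> z 0 = x \<and> z n = y}"
    by (intro CollectI exI conjI) (rule refl, simp_all)
  then show "{\<Sum>i=1..n. \<delta>\<phi> (z (i - 1)) (z i) | (n::nat) z. 1 \<le> n \<and> z 0 = x \<and> z n = y} \<noteq> {}"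
    by (metis empty_iff)
qed (use assms in blast)

lemma d\<phi>_nonneg: "0 \<le> d\<phi> x y"
  by (intro le_d\<phi>I chain_sum_nonneg)

lemma d\<phi>_le_\<delta>\<phi>: "d\<phi> x y \<le> \<delta>\<phi> x y"
  using d\<phi>_le_chain[of 1 "\<lambda>i. if i = 0 then x else y" x y] by simp

lemma d\<phi>_le_dist: "d\<phi> x y \<le> dist x y"
  using d\<phi>_le_\<delta>\<phi>[of x y] by (simp add: \<delta>\<phi>_def)

lemma d\<phi>_commute_le: "d\<phi> y x \<le> d\<phi> x y" for x y :: "real ^ 'n"
proof (rule le_d\<phi>I)
  fix n :: nat and z :: "nat \<Rightarrow> real ^ 'n" assume *: "1 \<le> n" "z 0 = x" "z n = y"
  have "d\<phi> y x \<le> (\<Sum>i=1..n. \<delta>\<phi> (z (n - (i - 1))) (z (n - i)))"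
    using d\<phi>_le_chain[of n "\<lambda>i. z (n - i)" y x] * by simp
  also have "\<dots> = (\<Sum>i=1..n. \<delta>\<phi> (z (i - 1)) (z i))"
  proof (rule sum.reindex_bij_witness[where i = "\<lambda>i. n + 1 - i" and j = "\<lambda>i. n + 1 - i"])
    fix i assume "i \<in> {1..n}"
    then show "\<delta>\<phi> (z (n + 1 - i - 1)) (z (n + 1 - i)) = \<delta>\<phi> (z (n - (i - 1))) (z (n - i))"
      by (subst \<delta>\<phi>_commute) (simp add: Suc_diff_le)
  qed auto
  finally show "d\<phi> y x \<le> (\<Sum>i=1..n. \<delta>\<phi> (z (i - 1)) (z i))" .
qed

lemma d\<phi>_triangle: "d\<phi> x w \<le> d\<phi> x y + d\<phi> y w" for x y w :: "real ^ 'n"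
proof -
  have "d\<phi> x w - (\<Sum>i=1..n. \<delta>\<phi> (z (i - 1)) (z i)) \<le> d\<phi> y w"
    if z: "1 \<le> n" "z 0 = x" "z n = y" for n :: nat and z
  proof (rule le_d\<phi>I)
    fix m :: nat and z' :: "nat \<Rightarrow> real ^ 'n" assume z': "1 \<le> m" "z' 0 = y" "z' m = w"
    let ?c = "\<lambda>i. if i \<le> n then z i else z' (i - n)"
    have "d\<phi> x w \<le> (\<Sum>i=1..n+m. \<delta>\<phi> (?c (i - 1)) (?c i))"
      using z z' by (intro d\<phi>_le_chain) auto
    also have "\<dots> = (\<Sum>i=1..n. \<delta>\<phi> (?c (i - 1)) (?c i)) + (\<Sum>i=n+1..n+m. \<delta>\<phi> (?c (i - 1)) (?c i))"
      by (rule sum.ub_add_nat) simp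
    also have "(\<Sum>i=1..n. \<delta>\<phi> (?c (i - 1)) (?c i)) = (\<Sum>i=1..n. \<delta>\<phi> (z (i - 1)) (z i))"
      by (intro sum.cong) auto
    also have "(\<Sum>i=n+1..n+m. \<delta>\<phi> (?c (i - 1)) (?c i)) = (\<Sum>i=1..m. \<delta>\<phi> (z' (i - 1)) (z' i))"
    proof (rule sum.reindex_bij_witness[where i = "\<lambda>i. i + n" and j = "\<lambda>i. i - n"])
      fix i assume i: "i \<in> {n+1..n+m}"
      then have "?c (i - 1) = z' (i - n - 1)"
        using z z' by (cases "i = n + 1") (auto simp: diff_commute)
      then show "\<delta>\<phi> (z' (i - n - 1)) (z' (i - n)) = \<delta>\<phi> (?c (i - 1)) (?c i)"
        using i by auto
    qed auto
    finally show "d\<phi> x w - (\<Sum>i=1..n. \<delta>\<phi> (z (i - 1)) (z i)) \<le> (\<Sum>i=1..m. \<delta>\<phi> (z' (i - 1)) (z' i))"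
      by simp
  qed
  then have "d\<phi> x w - d\<phi> y w \<le> d\<phi> x y"
    by (intro le_d\<phi>I) (smt (verit))
  then show ?thesis by simp
qed

lemma inverse_norm_lipschitz: "1 / (1 + dist 0 x) \<le> dist x y + 1 / (1 + dist 0 y)" for x y :: "real ^ 'n"
proof -
  have *: "dist 0 y - dist 0 x \<le> dist x y"
    using dist_triangle[of 0 y x] by simp
  moreover have "1 / (1 + dist 0 x) - 1 / (1 + dist 0 y) = (dist 0 y - dist 0 x) / ((1 + dist 0 x) * (1 + dist 0 y))"
    by (simp add: divide_simps add_nonneg_eq_0_iff)
  moreover have "\<dots> \<le> dist x y"
  proof (cases "dist 0 y \<ge> dist 0 x")
    case True
    have "1 \<le> (1 + dist 0 x) * (1 + dist 0 y)"
      using mult_mono[of 1 "1 + dist 0 x" 1 "1 + dist 0 y"] by simp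
    then have "(dist 0 y - dist 0 x) / ((1 + dist 0 x) * (1 + dist 0 y)) \<le> (dist 0 y - dist 0 x) / 1"
      using True by (intro divide_left_mono) auto
    from order_trans[OF this[unfolded div_by_1] *] show ?thesis .
  next
    case False
    then have "(dist 0 y - dist 0 x) / ((1 + dist 0 x) * (1 + dist 0 y)) \<le> 0"
      by (intro divide_nonpos_nonneg) auto
    then show ?thesis by (meson order_trans zero_le_dist)
  qed
  ultimately show ?thesis by linarith
qed

lemma chain_sum_lower:
  fixes n :: nat
  shows "min (dist (z 0) (z n)) (1 / (1 + dist 0 (z 0))) \<le> (\<Sum>i=1..n. \<delta>\<phi> (z (i - 1)) (z i))"
proof (induction n)
  case (Suc n)
  let ?s = "\<Sum>i=1..n. \<delta>\<phi> (z (i - 1)) (z i)"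
  have eq: "(\<Sum>i=1..Suc n. \<delta>\<phi> (z (i - 1)) (z i)) = ?s + \<delta>\<phi> (z n) (z (Suc n))" by simp
  have "\<delta>\<phi> (z n) (z (Suc n)) = dist (z n) (z (Suc n)) \<or> \<delta>\<phi> (z n) (z (Suc n)) \<ge> 1 / (1 + dist 0 (z n))"
    using \<phi>_nonneg[of "z n" "z (Suc n)"] by (auto simp: \<delta>\<phi>_def min_def)
  then show ?case
    unfolding eq
    using Suc.IH dist_triangle[of "z 0" "z (Suc n)" "z n"] inverse_norm_lipschitz[of "z 0" "z n"]
      \<delta>\<phi>_nonneg[of "z n" "z (Suc n)"]
    unfolding min_def by (smt (verit))
qed simp

lemma d\<phi>_lower: "min (dist x y) (1 / (1 + dist 0 x)) \<le> d\<phi> x y" for x y :: "real ^ 'n"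
proof (rule le_d\<phi>I)
  fix n :: nat and z :: "nat \<Rightarrow> real ^ 'n" assume "1 \<le> n" "z 0 = x" "z n = y"
  then show "min (dist x y) (1 / (1 + dist 0 x)) \<le> (\<Sum>i=1..n. \<delta>\<phi> (z (i - 1)) (z i))"
    using chain_sum_lower[of z n] by simp
qed

lemma Metric_space_d\<phi>: "Metric_space UNIV d\<phi>"
proof
  fix x y z :: "real ^ 'n"
  show "0 \<le> d\<phi> x y" by (rule d\<phi>_nonneg)
  show "d\<phi> x y = d\<phi> y x" using d\<phi>_commute_le by (metis order_antisym)
  show "d\<phi> x z \<le> d\<phi> x y + d\<phi> y z" by (rule d\<phi>_triangle)
  show "d\<phi> x y = 0 \<longleftrightarrow> x = y"
  proof
    assume "d\<phi> x y = 0"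
    then have "min (dist x y) (1 / (1 + dist 0 x)) \<le> 0" using d\<phi>_lower[of x y] by simp
    moreover have "1 / (1 + dist 0 x) > 0" by (simp add: add_pos_nonneg)
    ultimately show "x = y" by (simp add: min_le_iff_disj)
  next
    assume "x = y"
    then show "d\<phi> x y = 0" using d\<phi>_le_dist[of x y] d\<phi>_nonneg[of x y] by simp
  qed
qed

end

theory Submission
  imports Defs
begin

text \<open>
  The radial map \<open>x \<mapsto> x / (1 + |x|)\<close> identifies the whole space with the open unit ball, and it is
  uniformly continuous in both directions between $d^\phi$ and the Euclidean metric. A bijection
  of this kind extends to a homeomorphism of the completions, and the completion of the open ball
  is its closure (\<open>Cauchy_completion_homeomorphic_closure\<close>).

  In one direction the map is even Lipschitz with constant 2 (\<open>dist_squash_le_d\<phi>\<close>). Since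
  $d^\phi$ is the largest pseudometric below $\delta^\phi$, only $\delta^\phi$ has to be
  considered. The image of \<open>x\<close> is at distance \<open>1 / (1 + |x|)\<close> from the direction \<open>x / |x|\<close>, which
  is the penalty that $\delta^\phi$ charges for a jump at \<open>x\<close>, while on a sphere \<open>Sm m\<close> and along
  a ray through the spheres $\phi$ is the distance between the directions of the two points.
  Everywhere else $\phi$ is the Euclidean distance, for which the radial map is Lipschitz.

  In the other direction (\<open>d\<phi>_squash_uniform\<close>) bounded points are harmless, because there the
  radial map has a locally Lipschitz inverse for the Euclidean distance, which dominates
  $d^\phi$. A point \<open>x\<close> of large norm lies close to a sphere \<open>Sm m\<close>, because the gaps \<open>1 / (m + 1)\<close>
  of the harmonic numbers tend to 0 although the numbers themselves are unbounded. From that sphere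
  a jump along the ray and a jump within a sphere lead near any other far point, at a cost of the
  distance of the directions plus penalties that vanish at infinity
  (\<open>d\<phi>_le_far\<close>).
\<close>

section \<open>Completions and closures\<close>

text \<open>A uniform equivalence and its inverse both preserve Cauchy sequences and their equivalence,
  so taking limits of images is a bijection, and the moduli of continuity survive the passage to
  the limit.\<close>

lemma (in Metric_space) Cauchy_completion_homeomorphic_closure:
  fixes h :: "'a \<Rightarrow> 'b::complete_space"
  assumes fwd: "\<And>e. e > 0 \<Longrightarrow> \<exists>r>0. \<forall>x\<in>M. \<forall>y\<in>M. d x y < r \<longrightarrow> dist (h x) (h y) < e"
    and bwd: "\<And>e. e > 0 \<Longrightarrow> \<exists>r>0. \<forall>x\<in>M. \<forall>y\<in>M. dist (h x) (h y) < r \<longrightarrow> d x y < e"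
  shows "Metric_space.mtopology (Cauchy_completion M d) (Cauchy_completion_dist M d)
    homeomorphic_space top_of_set (closure (h ` M))"
proof -
  let ?C = "Cauchy_completion M d" and ?\<rho> = "Cauchy_completion_dist M d"
  let ?B = "closure (h ` M)"
  interpret C: Metric_space ?C ?\<rho> by (rule Metric_space_Cauchy_completion)
  interpret B: Submetric UNIV "dist :: 'b \<Rightarrow> 'b \<Rightarrow> real" ?B by unfold_locales simp
  have topB: "B.sub.mtopology = top_of_set ?B"
    by (simp add: B.mtopology_submetric)
  have inM: "\<sigma> i \<in> M" if "\<sigma> \<in> Cauchy_seqs M d" for \<sigma> i
    using that by (auto simp: Cauchy_seqs_def MCauchy_def)
  have Cauchy_h: "Cauchy (\<lambda>i. h (\<sigma> i))" if "\<sigma> \<in> Cauchy_seqs M d" for \<sigma>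
  proof (rule metric_CauchyI)
    fix e :: real assume "e > 0"
    then obtain r where "r > 0" and r: "\<And>x y. x \<in> M \<Longrightarrow> y \<in> M \<Longrightarrow> d x y < r \<Longrightarrow> dist (h x) (h y) < e"
      using fwd by blast
    have "MCauchy \<sigma>" using that by (simp add: Cauchy_seqs_def)
    then obtain N where "\<forall>n n'. N \<le> n \<longrightarrow> N \<le> n' \<longrightarrow> d (\<sigma> n) (\<sigma> n') < r"
      using \<open>r > 0\<close> unfolding MCauchy_def by blast
    then show "\<exists>N. \<forall>m\<ge>N. \<forall>n\<ge>N. dist (h (\<sigma> m)) (h (\<sigma> n)) < e"
      using r inM[OF that] by blast
  qed
  define F where "F X = lim (\<lambda>i. h ((SOME \<sigma>. \<sigma> \<in> X) i))" for X
  have ex: "\<exists>\<sigma>. \<sigma> \<in> X \<and> \<sigma> \<in> Cauchy_seqs M d \<and> (\<lambda>i. h (\<sigma> i)) \<longlonglongrightarrow> F X" if X: "X \<in> ?C" for X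
  proof -
    define \<sigma> where "\<sigma> = (SOME \<sigma>. \<sigma> \<in> X)"
    have \<sigma>: "\<sigma> \<in> X"
      using Cauchy_completion_nonempty[OF X] someI_ex[of "\<lambda>\<sigma>. \<sigma> \<in> X"] unfolding \<sigma>_def by metis
    then have "\<sigma> \<in> Cauchy_seqs M d"
      using X in_quotient_imp_subset[OF equiv_Cauchy_equiv] by (auto simp: Cauchy_completion_def)
    then show ?thesis
      using \<sigma> Cauchy_h Cauchy_convergent convergent_LIMSEQ_iff unfolding F_def \<sigma>_def by blast
  qed
  have F_uniform: "\<exists>r>0. \<forall>X\<in>?C. \<forall>Y\<in>?C. ?\<rho> X Y < r \<longrightarrow> dist (F X) (F Y) < e" if e: "e > 0" for e
  proof -
    obtain r where "r > 0" and r: "\<And>x y. x \<in> M \<Longrightarrow> y \<in> M \<Longrightarrow> d x y < r \<Longrightarrow> dist (h x) (h y) < e/2"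
      using fwd[OF half_gt_zero[OF e]] by blast
    have "dist (F X) (F Y) < e" if XY: "X \<in> ?C" "Y \<in> ?C" "?\<rho> X Y < r" for X Y
    proof -
      obtain \<sigma> where \<sigma>: "\<sigma> \<in> X" "\<sigma> \<in> Cauchy_seqs M d" "(\<lambda>i. h (\<sigma> i)) \<longlonglongrightarrow> F X"
        using ex XY by blast
      obtain \<tau> where \<tau>: "\<tau> \<in> Y" "\<tau> \<in> Cauchy_seqs M d" "(\<lambda>i. h (\<tau> i)) \<longlonglongrightarrow> F Y"
        using ex XY by blast
      have "\<forall>\<^sub>F i in sequentially. d (\<sigma> i) (\<tau> i) < r"
        using order_tendstoD(2)[OF Cauchy_completion_dist_eq] XY \<sigma> \<tau> by blast
      then have "\<forall>\<^sub>F i in sequentially. dist (h (\<sigma> i)) (h (\<tau> i)) \<le> e/2"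
        by eventually_elim (use r inM \<sigma> \<tau> in \<open>simp add: less_imp_le\<close>)
      then have "dist (F X) (F Y) \<le> e/2"
        using \<sigma> \<tau> by (intro tendsto_upperbound[OF tendsto_dist]) auto
      then show ?thesis using \<open>e > 0\<close> by simp
    qed
    then show ?thesis using \<open>r > 0\<close> by blast
  qed
  have F_uniform_inv: "\<exists>r>0. \<forall>X\<in>?C. \<forall>Y\<in>?C. dist (F X) (F Y) < r \<longrightarrow> ?\<rho> X Y < e" if e: "e > 0" for e
  proof -
    obtain r where "r > 0" and r: "\<And>x y. x \<in> M \<Longrightarrow> y \<in> M \<Longrightarrow> dist (h x) (h y) < r \<Longrightarrow> d x y < e/2"
      using bwd[OF half_gt_zero[OF e]] by blast
    have "?\<rho> X Y < e" if XY: "X \<in> ?C" "Y \<in> ?C" "dist (F X) (F Y) < r" for X Y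
    proof -
      obtain \<sigma> where \<sigma>: "\<sigma> \<in> X" "\<sigma> \<in> Cauchy_seqs M d" "(\<lambda>i. h (\<sigma> i)) \<longlonglongrightarrow> F X"
        using ex XY by blast
      obtain \<tau> where \<tau>: "\<tau> \<in> Y" "\<tau> \<in> Cauchy_seqs M d" "(\<lambda>i. h (\<tau> i)) \<longlonglongrightarrow> F Y"
        using ex XY by blast
      have "\<forall>\<^sub>F i in sequentially. dist (h (\<sigma> i)) (h (\<tau> i)) < r"
        using order_tendstoD(2)[OF tendsto_dist] XY \<sigma> \<tau> by blast
      then have "\<forall>\<^sub>F i in sequentially. d (\<sigma> i) (\<tau> i) \<le> e/2"
        by eventually_elim (use r inM \<sigma> \<tau> in \<open>simp add: less_imp_le\<close>)
      then have "?\<rho> X Y \<le> e/2"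
        using \<sigma> \<tau> XY by (intro tendsto_upperbound[OF Cauchy_completion_dist_eq]) auto
      then show ?thesis using \<open>e > 0\<close> by simp
    qed
    then show ?thesis using \<open>r > 0\<close> by blast
  qed
  have F_in: "F X \<in> ?B" if X: "X \<in> ?C" for X
  proof -
    obtain \<sigma> where "\<sigma> \<in> Cauchy_seqs M d" "(\<lambda>i. h (\<sigma> i)) \<longlonglongrightarrow> F X"
      using ex[OF X] by blast
    then show ?thesis
      unfolding closure_sequential using inM by (intro exI[of _ "\<lambda>i. h (\<sigma> i)"]) auto
  qed
  have inj: "inj_on F ?C"
  proof (rule inj_onI)
    fix X Y assume XY: "X \<in> ?C" "Y \<in> ?C" "F X = F Y"
    have "?\<rho> X Y < e" if "e > 0" for e
      using F_uniform_inv[OF that] XY by auto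
    from this[of "?\<rho> X Y"] have "\<not> 0 < ?\<rho> X Y" by blast
    then have "?\<rho> X Y = 0" using C.nonneg[of X Y] by simp
    then show "X = Y" using XY by simp
  qed
  have surj: "?B \<subseteq> F ` ?C"
  proof
    fix b assume "b \<in> ?B"
    then obtain w where w: "\<And>i. w i \<in> h ` M" "w \<longlonglongrightarrow> b"
      by (auto simp: closure_sequential)
    then have "\<forall>i. \<exists>x. x \<in> M \<and> w i = h x" by blast
    then obtain \<sigma> where \<sigma>: "\<And>i. \<sigma> i \<in> M" "\<And>i. w i = h (\<sigma> i)" by metis
    have Cauchy_\<sigma>: "\<sigma> \<in> Cauchy_seqs M d"
      unfolding Cauchy_seqs_def MCauchy_def mem_Collect_eq
    proof (intro conjI allI impI)
      fix e :: real assume "e > 0"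
      then obtain r where "r > 0" and r: "\<And>x y. x \<in> M \<Longrightarrow> y \<in> M \<Longrightarrow> dist (h x) (h y) < r \<Longrightarrow> d x y < e"
        using bwd by blast
      moreover have "Cauchy w" using w(2) LIMSEQ_imp_Cauchy by blast
      ultimately obtain N where "\<forall>m\<ge>N. \<forall>n\<ge>N. dist (w m) (w n) < r"
        using metric_CauchyD by blast
      then show "\<exists>N. \<forall>n n'. N \<le> n \<longrightarrow> N \<le> n' \<longrightarrow> d (\<sigma> n) (\<sigma> n') < e"
        using r \<sigma> by metis
    qed (use \<sigma> in auto)
    define X where "X = Cauchy_equiv M d `` {\<sigma>}"
    have X: "X \<in> ?C" "\<sigma> \<in> X"
      using Cauchy_\<sigma> equiv_class_self[OF equiv_Cauchy_equiv]
      by (auto simp: X_def Cauchy_completion_def intro: quotientI)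
    have le: "dist (F X) b \<le> e" if e: "e > 0" for e
    proof -
      obtain \<tau> where \<tau>: "\<tau> \<in> X" "\<tau> \<in> Cauchy_seqs M d" "(\<lambda>i. h (\<tau> i)) \<longlonglongrightarrow> F X"
        using ex X by blast
      obtain r where "r > 0" and r: "\<And>x y. x \<in> M \<Longrightarrow> y \<in> M \<Longrightarrow> d x y < r \<Longrightarrow> dist (h x) (h y) < e"
        using fwd[OF e] by blast
      have "(\<lambda>i. d (\<tau> i) (\<sigma> i)) \<longlonglongrightarrow> 0"
        using Cauchy_completion_dist_eq[of X X \<tau> \<sigma>] X \<tau> by simp
      then have "\<forall>\<^sub>F i in sequentially. d (\<tau> i) (\<sigma> i) < r"
        using \<open>r > 0\<close> order_tendstoD(2) by blast
      then have "\<forall>\<^sub>F i in sequentially. dist (h (\<tau> i)) (w i) \<le> e"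
        by eventually_elim (use r inM \<sigma> \<tau> in \<open>simp add: less_imp_le\<close>)
      then show ?thesis
        using \<tau> w by (intro tendsto_upperbound[OF tendsto_dist]) auto
    qed
    have "dist (F X) b \<le> 0"
      by (rule field_le_epsilon) (simp add: le)
    then have "F X = b" by simp
    then show "b \<in> F ` ?C" using X by blast
  qed
  let ?G = "inv_into ?C F"
  have G: "?G b \<in> ?C" "F (?G b) = b" if "b \<in> ?B" for b
    using surj that by (auto intro: inv_into_into f_inv_into_f)
  have "continuous_map C.mtopology B.sub.mtopology F"
    unfolding C.metric_continuous_map[OF B.sub.Metric_space_axioms]
    using F_uniform F_in by (auto simp: image_subset_iff) meson
  moreover have "continuous_map B.sub.mtopology C.mtopology ?G"
    unfolding B.sub.metric_continuous_map[OF C.Metric_space_axioms]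
  proof (intro conjI ballI allI impI)
    show "?G ` ?B \<subseteq> ?C" using G by blast
    fix b and e :: real assume "b \<in> ?B" "e > 0"
    then show "\<exists>r>0. \<forall>x. x \<in> ?B \<and> dist b x < r \<longrightarrow> ?\<rho> (?G b) (?G x) < e"
      using F_uniform_inv[of e] G by metis
  qed
  ultimately have "homeomorphic_maps C.mtopology B.sub.mtopology F ?G"
    using inj G by (simp add: homeomorphic_maps_def)
  then show ?thesis
    unfolding topB[symmetric] homeomorphic_space_def by blast
qed


section \<open>The radial map onto the open ball\<close>

definition squash :: "'a::real_normed_vector \<Rightarrow> 'a"
  where "squash x = x /\<^sub>R (1 + norm x)"

lemma norm_squash: "norm (squash x) = norm x / (1 + norm x)"
  by (simp add: squash_def divide_inverse mult.commute)

lemma scaleR_squash: "(1 + norm x) *\<^sub>R squash x = x"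
  by (simp add: squash_def add_nonneg_eq_0_iff)

lemma range_squash: "range (squash :: 'a::real_normed_vector \<Rightarrow> 'a) = ball 0 1"
proof (intro equalityI subsetI)
  fix y :: 'a assume "y \<in> range squash"
  then show "y \<in> ball 0 1"
    by (auto simp: norm_squash divide_less_eq add_pos_nonneg)
next
  fix y :: 'a assume "y \<in> ball 0 1"
  then have y: "norm y < 1" by simp
  then have "1 + norm (y /\<^sub>R (1 - norm y)) = inverse (1 - norm y)"
    by (simp add: field_simps)
  then have "squash (y /\<^sub>R (1 - norm y)) = y"
    using y by (simp add: squash_def)
  then show "y \<in> range squash" by (metis rangeI)
qed

text \<open>Both estimates come from
  \<open>x - y = (1 + |x|) (squash x - squash y) + (|x| - |y|) squash y\<close>.\<close>

lemma dist_squash_le: "dist (squash x) (squash y) \<le> 2 * dist x y"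
proof -
  have eq: "(1 + norm x) *\<^sub>R (squash x - squash y) = (x - y) - (norm x - norm y) *\<^sub>R squash y"
    using scaleR_squash[of x] scaleR_squash[of y] by (simp add: algebra_simps)
  have "norm (squash x - squash y) \<le> (1 + norm x) * norm (squash x - squash y)"
    by (simp add: distrib_right)
  also have "\<dots> = norm ((x - y) - (norm x - norm y) *\<^sub>R squash y)"
    unfolding eq[symmetric] by simp
  also have "\<dots> \<le> norm (x - y) + \<bar>norm x - norm y\<bar> * norm (squash y)"
    by (metis norm_scaleR norm_triangle_ineq4)
  also have "\<bar>norm x - norm y\<bar> * norm (squash y) \<le> norm (x - y) * 1"
    by (intro mult_mono norm_triangle_ineq3) (auto simp: norm_squash divide_le_eq add_pos_nonneg)
  finally show ?thesis by (simp add: dist_norm)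
qed

lemma dist_le_dist_squash:
  "dist x y \<le> (1 + norm x) * (1 + norm y) * dist (squash x) (squash y)"
proof -
  have eq: "x - y = (1 + norm x) *\<^sub>R (squash x - squash y) + (norm x - norm y) *\<^sub>R squash y"
    using scaleR_squash[of x] scaleR_squash[of y] by (simp add: algebra_simps)
  have "norm (x - y) \<le> (1 + norm x) * norm (squash x - squash y) + \<bar>norm x - norm y\<bar> * norm (squash y)"
    by (subst eq) (rule norm_triangle_le, simp)
  also have "\<bar>norm x - norm y\<bar> * norm (squash y) \<le> norm (x - y) * norm (squash y)"
    by (intro mult_right_mono norm_triangle_ineq3) auto
  finally have "norm (x - y) * (1 - norm (squash y)) \<le> (1 + norm x) * norm (squash x - squash y)"
    by (simp add: algebra_simps)
  moreover have "1 - norm (squash y) = 1 / (1 + norm y)"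
    by (simp add: norm_squash field_simps add_nonneg_eq_0_iff)
  ultimately have "norm (x - y) / (1 + norm y) \<le> (1 + norm x) * norm (squash x - squash y)"
    by simp
  then show ?thesis
    by (simp add: dist_norm divide_le_eq add_pos_nonneg mult_ac)
qed

lemma dist_squash_sgn:
  assumes "x \<noteq> 0"
  shows "dist (squash x) (sgn x) = 1 / (1 + norm x)"
proof -
  have "squash x - sgn x = (1 / (1 + norm x) - 1 / norm x) *\<^sub>R x"
    by (simp add: squash_def sgn_div_norm algebra_simps inverse_eq_divide)
  then have "dist (squash x) (sgn x) = \<bar>1 / (1 + norm x) - 1 / norm x\<bar> * norm x"
    by (simp add: dist_norm)
  also have "1 / (1 + norm x) - 1 / norm x = - (1 / ((1 + norm x) * norm x))"
    using assms by (simp add: field_simps add_nonneg_eq_0_iff)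
  finally show ?thesis using assms by (simp add: abs_mult)
qed


section \<open>The radial map is Lipschitz\<close>

text \<open>Both special values of $\phi$ are the distance of the directions: on a ray this distance is 0,
  and on \<open>Sm m\<close> the factor \<open>1 / harm m\<close> rescales the sphere to the unit sphere.\<close>

lemma \<phi>_cases:
  fixes x y :: "real ^ 'n"
  obtains (direction) "x \<noteq> 0" "y \<noteq> 0" "\<phi> x y = dist (sgn x) (sgn y)"
  | (far) "\<phi> x y = dist x y"
proof (cases "\<exists>p\<ge>1. \<exists>q\<ge>1. x \<in> Sm p \<and> hpq p q x = y")
  case True
  then obtain p q where pq: "1 \<le> p" "1 \<le> q" "x \<in> Sm p" "hpq p q x = y" by blast
  then have pos: "harm p > (0::real)" "harm q > (0::real)" by auto
  have neq: "harm p \<noteq> (0::real)" "harm q \<noteq> (0::real)" using pq by (auto simp: harm_neq_0)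
  have "norm x = harm p" using pq(3) by (simp add: Sm_def)
  then have "0 < norm x" using pos(1) by metis
  then have "x \<noteq> 0" by simp
  moreover have "sgn y = sgn x"
    using pq(4) pos by (auto simp: hpq_def sgn_scaleR)
  moreover have "y \<noteq> 0" using pq(4) neq \<open>x \<noteq> 0\<close> by (auto simp: hpq_def)
  moreover have "\<phi> x y = 0" using True by (simp add: \<phi>_def)
  ultimately show ?thesis using direction by simp
next
  case False
  show ?thesis
  proof (cases "\<exists>m\<ge>1. x \<in> Sm m \<and> y \<in> Sm m")
    case True
    then obtain m where m: "1 \<le> m" "x \<in> Sm m" "y \<in> Sm m" by blast
    then have n: "norm x = harm m" "norm y = harm m" "harm m > (0::real)" by (auto simp: Sm_def)
    have "dist (sgn x) (sgn y) = dist x y / harm m"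
      using n by (simp add: sgn_div_norm dist_norm divide_inverse flip: scaleR_diff_right)
    then have "\<phi> x y = dist (sgn x) (sgn y)" using \<phi>_sphere[OF m] by simp
    then show ?thesis using direction n by fastforce
  next
    case no_sphere: False
    show ?thesis by (rule far) (simp only: \<phi>_def if_not_P[OF False] if_not_P[OF no_sphere])
  qed
qed

lemma dist_squash_le_\<delta>\<phi>:
  fixes x y :: "real ^ 'n"
  shows "dist (squash x) (squash y) \<le> 2 * \<delta>\<phi> x y"
proof -
  have "dist (squash x) (squash y) \<le> 2 * (1 / (1 + norm x) + \<phi> x y + 1 / (1 + norm y))"
  proof (cases x y rule: \<phi>_cases)
    case direction
    have "dist (squash x) (squash y)
        \<le> dist (squash x) (sgn x) + dist (sgn x) (sgn y) + dist (squash y) (sgn y)"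
      using dist_triangle[of "squash x" "squash y" "sgn x"]
        dist_triangle[of "sgn x" "squash y" "sgn y"] by (simp add: dist_commute)
    also have "\<dots> = 1 / (1 + norm x) + \<phi> x y + 1 / (1 + norm y)" (is "_ = ?c")
      using direction by (simp add: dist_squash_sgn)
    also have "\<dots> \<le> 2 * ?c"
    proof -
      have "0 \<le> ?c" using \<phi>_nonneg[of x y] by (intro add_nonneg_nonneg) auto
      then show ?thesis unfolding mult_2 by (rule add_increasing[OF _ order_refl])
    qed
    finally show ?thesis .
  next
    case far
    have "dist (squash x) (squash y) \<le> 2 * \<phi> x y"
      using far dist_squash_le[of x y] by simp
    also have "\<phi> x y \<le> 1 / (1 + norm x) + \<phi> x y + 1 / (1 + norm y)"
      by simp
    finally show ?thesis by simp
  qed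
  then show ?thesis
    using dist_squash_le[of x y] by (simp add: \<delta>\<phi>_def min_def)
qed

lemma dist_squash_le_d\<phi>:
  fixes x y :: "real ^ 'n"
  shows "dist (squash x) (squash y) \<le> 2 * d\<phi> x y"
proof -
  have chain: "dist (squash (z 0)) (squash (z n)) \<le> 2 * (\<Sum>i=1..n. \<delta>\<phi> (z (i - 1)) (z i))"
    for n :: nat and z :: "nat \<Rightarrow> real ^ 'n"
  proof (induction n)
    case (Suc n)
    then show ?case
      using dist_triangle[of "squash (z 0)" "squash (z (Suc n))" "squash (z n)"]
        dist_squash_le_\<delta>\<phi>[of "z n" "z (Suc n)"] by simp
  qed simp
  have "dist (squash x) (squash y) / 2 \<le> d\<phi> x y"
  proof (rule le_d\<phi>I)
    fix n :: nat and z :: "nat \<Rightarrow> real ^ 'n" assume "1 \<le> n" "z 0 = x" "z n = y"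
    then show "dist (squash x) (squash y) / 2 \<le> (\<Sum>i=1..n. \<delta>\<phi> (z (i - 1)) (z i))"
      using chain[of z n] by simp
  qed
  then show ?thesis by simp
qed


section \<open>Uniform continuity of the inverse\<close>

text \<open>The gaps of the harmonic numbers are controlled by the crude bound \<open>harm (m + 1) \<le> m + 1\<close>.\<close>

lemma harm_bracket:
  fixes r :: real
  assumes "1 \<le> r"
  obtains m where "1 \<le> m" "harm m \<le> r" "r - harm m \<le> 1 / r" "r \<le> 1 + harm m"
proof -
  have "\<forall>\<^sub>F n in sequentially. r < harm n"
    using harm_at_top unfolding filterlim_at_top_dense by blast
  then have ex: "\<exists>n. r < harm n" by (auto simp: eventually_sequentially)
  define k where "k = (LEAST n. r < harm n)"
  have k: "r < harm k" and least: "\<And>n. n < k \<Longrightarrow> harm n \<le> r"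
    unfolding k_def using LeastI_ex[OF ex] not_less_Least by (blast, force)
  have "harm 0 = (0::real)" "harm 1 = (1::real)" by (simp_all add: harm_def)
  then have "harm 0 \<le> r" "harm 1 \<le> r" using assms by simp_all
  then have "k \<noteq> 0" "k \<noteq> 1" using k by (intro notI; simp)+
  then obtain m where m: "k = Suc m" "1 \<le> m" by (cases k) auto
  have "(harm n :: real) \<le> real n" for n
  proof (induction n)
    case (Suc n)
    have "inverse (real (Suc n)) \<le> 1" by (simp add: field_simps)
    then show ?case using Suc by (simp add: harm_Suc)
  qed (simp add: harm_def)
  from this[of k] have "r \<le> real (Suc m)" using k m by simp
  then have "inverse (real (Suc m)) \<le> 1 / r"
    using assms by (simp add: field_simps)
  moreover have "inverse (real (Suc m)) \<le> 1" by (simp add: field_simps)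
  ultimately show ?thesis
    using that[of m] m k least[of m] by (simp add: harm_Suc)
qed

lemma near_sphere:
  fixes x :: "real ^ 'n"
  assumes "1 \<le> norm x"
  obtains m where "1 \<le> m" "harm m *\<^sub>R sgn x \<in> Sm m" "dist x (harm m *\<^sub>R sgn x) \<le> 1 / norm x"
    "1 / (1 + harm m) \<le> 1 / norm x"
proof -
  obtain m where m: "1 \<le> m" "harm m \<le> norm x" "norm x - harm m \<le> 1 / norm x" "norm x \<le> 1 + harm m"
    using harm_bracket[OF assms] by blast
  have sgn: "norm (sgn x) = 1" using assms by (auto simp: norm_sgn)
  have scaleR_sgn: "norm x *\<^sub>R sgn x = x"
    using assms by (cases "x = 0") (simp_all add: sgn_div_norm)
  have "x - harm m *\<^sub>R sgn x = (norm x - harm m) *\<^sub>R sgn x"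
    using scaleR_sgn by (simp add: scaleR_diff_left)
  then have "dist x (harm m *\<^sub>R sgn x) = norm x - harm m"
    using m sgn by (simp add: dist_norm)
  moreover have "harm m *\<^sub>R sgn x \<in> Sm m"
    using sgn by (simp add: Sm_def harm_nonneg)
  moreover have "1 / (1 + harm m) \<le> 1 / norm x"
    using m assms by (intro divide_left_mono mult_pos_pos) auto
  ultimately show ?thesis using that m by simp
qed

text \<open>The chain behind this bound moves radially from \<open>x\<close> to the nearest sphere below it, jumps
  along the ray to the sphere below \<open>y\<close>, jumps within that sphere to the ray of \<open>y\<close>, and moves
  radially to \<open>y\<close>.\<close>

lemma d\<phi>_le_far:
  fixes x y :: "real ^ 'n"
  assumes "1 \<le> norm x" "1 \<le> norm y"
  shows "d\<phi> x y \<le> 3 / norm x + 5 / norm y + dist (squash x) (squash y)"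
proof -
  obtain m where m: "1 \<le> m" "harm m *\<^sub>R sgn x \<in> Sm m" "dist x (harm m *\<^sub>R sgn x) \<le> 1 / norm x"
    "1 / (1 + harm m) \<le> 1 / norm x"
    using near_sphere assms by blast
  obtain n where n: "1 \<le> n" "harm n *\<^sub>R sgn y \<in> Sm n" "dist y (harm n *\<^sub>R sgn y) \<le> 1 / norm y"
    "1 / (1 + harm n) \<le> 1 / norm y"
    using near_sphere assms by blast
  define x1 where "x1 = harm m *\<^sub>R sgn x"
  define x2 where "x2 = harm n *\<^sub>R sgn x"
  define y1 where "y1 = harm n *\<^sub>R sgn y"
  have pos: "harm m > (0::real)" "harm n > (0::real)" using m n by auto
  have sgn: "norm (sgn x) = 1" "norm (sgn y) = 1" using assms by (auto simp: norm_sgn)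
  have norms: "norm x1 = harm m" "norm x2 = harm n" "norm y1 = harm n"
    using pos sgn by (auto simp: x1_def x2_def y1_def)
  have "harm m \<noteq> (0::real)" using m by (simp add: harm_neq_0)
  then have "hpq m n x1 = x2" by (simp add: hpq_def x1_def x2_def)
  then have "\<phi> x1 x2 = 0"
    using \<phi>_ray[OF m(1) n(1) m(2)] by (simp add: x1_def)
  then have d12: "d\<phi> x1 x2 \<le> 1 / norm x + 1 / norm y"
    using d\<phi>_le_\<delta>\<phi>[of x1 x2] m n norms by (simp add: \<delta>\<phi>_def)
  have "\<phi> x2 y1 = 1 / harm n * dist x2 y1"
    using n norms by (intro \<phi>_sphere) (auto simp: Sm_def)
  also have "dist x2 y1 = harm n * dist (sgn x) (sgn y)"
    using pos by (simp add: x2_def y1_def dist_norm flip: scaleR_diff_right)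
  finally have "\<phi> x2 y1 = dist (sgn x) (sgn y)" using pos by simp
  then have d23: "d\<phi> x2 y1 \<le> 2 / norm y + dist (sgn x) (sgn y)"
    using d\<phi>_le_\<delta>\<phi>[of x2 y1] n norms by (simp add: \<delta>\<phi>_def)
  have dist_sgn: "dist (sgn x) (sgn y)
      \<le> dist (squash x) (sgn x) + dist (squash x) (squash y) + dist (squash y) (sgn y)"
    using dist_triangle[of "sgn x" "sgn y" "squash x"]
        dist_triangle[of "squash x" "sgn y" "squash y"] by (simp add: dist_commute)
  have "dist (squash v) (sgn v) \<le> 1 / norm v" if "1 \<le> norm v" for v :: "real ^ 'n"
  proof -
    have "v \<noteq> 0" using that by auto
    then show ?thesis using that by (simp add: dist_squash_sgn frac_le)
  qed
  from this[OF assms(1)] this[OF assms(2)]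
  have sgns: "dist (sgn x) (sgn y) \<le> 1 / norm x + dist (squash x) (squash y) + 1 / norm y"
    using dist_sgn by linarith
  have "d\<phi> x x1 \<le> 1 / norm x" "d\<phi> y1 y \<le> 1 / norm y"
    using d\<phi>_le_dist[of x x1] d\<phi>_le_dist[of y1 y] m n by (auto simp: x1_def y1_def dist_commute)
  then have "d\<phi> x y \<le> 3 * (1 / norm x) + 5 * (1 / norm y) + dist (squash x) (squash y)"
    using d12 d23 sgns d\<phi>_triangle[of x y x1] d\<phi>_triangle[of x1 y x2] d\<phi>_triangle[of x2 y y1]
    by simp
  then show ?thesis by simp
qed

text \<open>The bound on \<open>dist (squash x) (squash y)\<close> keeps \<open>y\<close> from escaping to infinity.\<close>

lemma dist_le_near:
  assumes "norm x \<le> R" "dist (squash x) (squash y) \<le> 1 / (2 * (1 + R))"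
  shows "dist x y \<le> 2 * (1 + R)\<^sup>2 * dist (squash x) (squash y)"
proof -
  define t where "t = dist (squash x) (squash y)"
  define D where "D = dist x y"
  have R: "0 \<le> R" using assms(1) norm_ge_zero order_trans by blast
  have "norm y \<le> R + D"
    using assms(1) dist_triangle[of 0 y x] by (simp add: D_def)
  moreover have "0 \<le> D" by (simp add: D_def)
  ultimately have "(1 + norm x) * (1 + norm y) * t \<le> (1 + R) * (1 + R + D) * t"
    using assms(1) R by (intro mult_mono) (auto simp: t_def)
  then have "D \<le> (1 + R) * (1 + R + D) * t"
    using dist_le_dist_squash[of x y] by (simp add: t_def D_def)
  also have "\<dots> = (1 + R)\<^sup>2 * t + D * ((1 + R) * t)"
    by (simp add: power2_eq_square algebra_simps)
  also have "D * ((1 + R) * t) \<le> D * (1 / 2)"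
    using assms(2) R by (intro mult_left_mono) (auto simp: t_def D_def field_simps)
  finally show ?thesis by (simp add: D_def t_def)
qed

lemma d\<phi>_squash_uniform:
  fixes e :: real
  assumes "e > 0"
  shows "\<exists>r>0. \<forall>x y :: real ^ 'n. dist (squash x) (squash y) < r \<longrightarrow> d\<phi> x y < e"
proof -
  \<comment> \<open>From this radius on, the two penalty terms of the far bound add up to at most \<open>e / 2\<close>.\<close>
  define R where "R = max 1 (16 / e)"
  define r where "r = min (e / 2) (min (1 / (2 * (1 + R))) (e / (2 * (1 + R)\<^sup>2)))"
  have R: "1 \<le> R" "8 / R \<le> e / 2"
    using assms by (auto simp: R_def field_simps max_def)
  have "r > 0" using assms R by (simp add: r_def)
  have near: "d\<phi> x y < e" if "norm x \<le> R" "dist (squash x) (squash y) < r" for x y :: "real ^ 'n"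
  proof -
    have "dist x y \<le> 2 * (1 + R)\<^sup>2 * dist (squash x) (squash y)"
      using that by (intro dist_le_near) (auto simp: r_def)
    also have "\<dots> < 2 * (1 + R)\<^sup>2 * (e / (2 * (1 + R)\<^sup>2))"
      using that R by (intro mult_strict_left_mono) (auto simp: r_def)
    also have "\<dots> = e" using R by simp
    finally show ?thesis using d\<phi>_le_dist[of x y] by simp
  qed
  have "d\<phi> x y < e" if xy: "dist (squash x) (squash y) < r" for x y :: "real ^ 'n"
  proof -
    consider "norm x \<le> R" | "norm y \<le> R" | "R < norm x" "R < norm y" by linarith
    then show ?thesis
    proof cases
      case 1
      then show ?thesis using near xy by blast
    next
      case 2
      then have "d\<phi> y x < e" using near xy by (simp add: dist_commute)
      then show ?thesis using d\<phi>_commute_le[of x y] d\<phi>_commute_le[of y x] by simp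
    next
      case 3
      have "3 / norm x \<le> 3 / R" "5 / norm y \<le> 5 / R"
        using 3 R by (intro divide_left_mono mult_pos_pos; linarith)+
      moreover have "3 / R + 5 / R = 8 / R" by (simp add: add_divide_distrib[symmetric])
      moreover have "dist (squash x) (squash y) < e / 2" using xy by (simp add: r_def)
      ultimately show ?thesis
        using d\<phi>_le_far[of x y] 3 R by simp
    qed
  qed
  then show ?thesis using \<open>r > 0\<close> by blast
qed


section \<open>The completion is the closed ball\<close>

theorem mainTheorem4:
  assumes "CARD('n::finite) \<ge> 2"
  shows "Metric_space.mtopology
            (Cauchy_completion UNIV (d\<phi> :: real ^ 'n \<Rightarrow> real ^ 'n \<Rightarrow> real))
            (Cauchy_completion_dist UNIV d\<phi>)
         homeomorphic_space
         top_of_set {x :: real ^ 'n. dist 0 x \<le> 1}"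
proof -
  interpret Metric_space "UNIV :: (real ^ 'n) set" d\<phi> by (rule Metric_space_d\<phi>)
  have "Metric_space.mtopology (Cauchy_completion UNIV (d\<phi> :: real ^ 'n \<Rightarrow> real ^ 'n \<Rightarrow> real))
      (Cauchy_completion_dist UNIV d\<phi>)
    homeomorphic_space top_of_set (closure (range (squash :: real ^ 'n \<Rightarrow> real ^ 'n)))"
  proof (rule Cauchy_completion_homeomorphic_closure)
    fix e :: real assume "e > 0"
    show "\<exists>r>0. \<forall>x\<in>UNIV. \<forall>y\<in>UNIV. d\<phi> x y < r \<longrightarrow> dist (squash x) (squash y :: real ^ 'n) < e"
    proof (intro exI[of _ "e / 2"] conjI ballI impI)
      fix x y :: "real ^ 'n" assume "d\<phi> x y < e / 2"
      then show "dist (squash x) (squash y) < e" using dist_squash_le_d\<phi>[of x y] by simp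
    qed (use \<open>e > 0\<close> in simp)
    show "\<exists>r>0. \<forall>x\<in>UNIV. \<forall>y\<in>UNIV. dist (squash x) (squash y :: real ^ 'n) < r \<longrightarrow> d\<phi> x y < e"
      using d\<phi>_squash_uniform[OF \<open>e > 0\<close>] by blast
  qed
  also have "closure (range (squash :: real ^ 'n \<Rightarrow> real ^ 'n)) = {x. dist 0 x \<le> 1}"
    by (simp add: range_squash cball_def)
  finally show ?thesis .
qed

end
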